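(* Consider the Pareto model with parameter set $\Theta=(1,\infty)$, let $k>0$ be fixed and let $\gamma\in[1,\infty)$. Then for every sequence $(\beta_N)_{N\ge1}$ with $\beta_N\ge1$ for all $N$ (with any dependence on $N$), the DR-integrated tail $(\mathcal{E}^{k,\gamma}_{\mathcal{Q}|\mathbf{x}_N}\circ \mathrm{IT}_{\beta_N})(X)$ is regularizable.
   Context: Pareto model: $X, X_1,X_2,\dots$ are real random variables and $\mathcal{Q}=\{Q_\theta:\theta\in\Theta\}$ is the family of measures under which they are iid with density $f(x;\theta)=\theta x^{-(1+\theta)}$ for $x>1$. Here $\Theta=(1,\infty)$. Write $\mathbf{x}_N=(X_1,\dots,X_N)$, $\ell(\mathbf{x}_N;\theta)=\sum_{i=1}^N\log f(X_i;\theta)$, and define the divergence $\alpha_{\mathcal{Q}|\mathbf{x}_N}(\theta)=\sup_{\theta'\in\Theta}\ell(\mathbf{x}_N;\theta')-\ell(\mathbf{x}_N;\theta)$. For $\delta\in\mathbb{R}$, the $\delta$-truncation is $\alpha^{(\delta)}_{\mathcal{Q}|\mathbf{x}_N}(\theta)=\alpha_{\mathcal{Q}|\mathbf{x}_N}(\theta)$ if $\alpha_{\mathcal{Q}|\mathbf{x}_N}(\theta)\le N^\delta$ and $+\infty$ otherwise. For a risk assessment $\mathcal{R}$ (a map from laws on $\mathbb{R}$ to values in $(-\infty,\infty]$), write $\mathcal{R}_\theta$ for its value on the law of $X$ under $Q_\theta$. For $k>0$ and $\gamma\in[1,\infty)$, put $$(\mathcal{E}^{k,\gamma,\delta}_{\mathcal{Q}|\mathbf{x}_N}\circ\mathcal{R})(X)=\sup_{\theta\in\Theta}\Big\{\mathcal{R}_\theta-\Big(\tfrac1k\alpha^{(\delta)}_{\mathcal{Q}|\mathbf{x}_N}(\theta)\Big)^\gamma\Big\},$$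 where parameters with infinite penalty are excluded from the supremum. This quantity is called regular (for given observations $\mathbf{x}_N$) if the supremum is finite and attained at a point $\theta$ with $\alpha_{\mathcal{Q}|\mathbf{x}_N}(\theta)<N^\delta$. For a sequence $(\mathcal{R}_N)$ of risk assessments, $(\mathcal{E}^{k,\gamma}_{\mathcal{Q}|\mathbf{x}_N}\circ\mathcal{R}_N)(X)$ is called regularizable if there exists $\delta>0$ such that, for every $P\in\mathcal{Q}$, with $P$-probability tending to $1$ as $N\to\infty$, $(\mathcal{E}^{k,\gamma,\delta}_{\mathcal{Q}|\mathbf{x}_N}\circ\mathcal{R}_N)(X)$ is regular. The integrated tail at level $\beta\ge1$ under $Q_\theta$ is $\mathrm{IT}_\beta(X)=E_{Q_\theta}[(X-\beta)^+]=\frac{\beta^{1-\theta}}{\theta-1}$. *)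

theory Defs
  imports "HOL-Probability.Probability"
begin

text \<open>
  A statistical model is given by a parameter set \<open>\<Theta>\<close>, densities \<open>f \<theta>\<close> with respect to
  Lebesgue measure, measures \<open>Q \<theta>\<close> on one common measurable space, and real random variables
  \<open>X 0, X 1, X 2, \<dots>\<close>.  The random variable \<open>X\<close> whose risk is assessed is \<open>X 0\<close>;
  the observations are \<open>X 1, \<dots>, X N\<close>.
\<close>

definition iid_density_model ::
  "'a measure \<Rightarrow> 'p set \<Rightarrow> ('p \<Rightarrow> real \<Rightarrow> real) \<Rightarrow> ('p \<Rightarrow> 'a measure) \<Rightarrow> (nat \<Rightarrow> 'a \<Rightarrow> real) \<Rightarrow> bool"
  where
  "iid_density_model M \<Theta> f Q X \<longleftrightarrow>
     (\<forall>\<theta>\<in>\<Theta>. prob_space (Q \<theta>) \<and> sets (Q \<theta>) = sets M \<and>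
        prob_space.indep_vars (Q \<theta>) (\<lambda>_. borel) X UNIV \<and>
        (\<forall>i. distributed (Q \<theta>) lborel (X i) (\<lambda>x. ennreal (f \<theta> x))))"

definition pareto_density :: "real \<Rightarrow> real \<Rightarrow> real" where
  "pareto_density \<theta> x = (if x > 1 then \<theta> * x powr (- (1 + \<theta>)) else 0)"

text \<open>
  The log-likelihood takes the value \<open>-\<infinity>\<close> where the density vanishes; the convention
  \<open>- \<infinity> - (- \<infinity>) = \<infinity>\<close> of \<^typ>\<open>ereal\<close> then makes the divergence infinite.
  For the true data this happens with probability zero.
\<close>

definition log_lik :: "('p \<Rightarrow> real \<Rightarrow> real) \<Rightarrow> nat \<Rightarrow> (nat \<Rightarrow> real) \<Rightarrow> 'p \<Rightarrow> ereal" where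
  "log_lik f N x \<theta> =
     (\<Sum>i=1..N. if f \<theta> (x i) > 0 then ereal (ln (f \<theta> (x i))) else - \<infinity>)"

definition divergence ::
  "'p set \<Rightarrow> ('p \<Rightarrow> real \<Rightarrow> real) \<Rightarrow> nat \<Rightarrow> (nat \<Rightarrow> real) \<Rightarrow> 'p \<Rightarrow> ereal" where
  "divergence \<Theta> f N x \<theta> = (SUP \<theta>'\<in>\<Theta>. log_lik f N x \<theta>') - log_lik f N x \<theta>"

definition truncated_divergence ::
  "'p set \<Rightarrow> ('p \<Rightarrow> real \<Rightarrow> real) \<Rightarrow> real \<Rightarrow> nat \<Rightarrow> (nat \<Rightarrow> real) \<Rightarrow> 'p \<Rightarrow> ereal" where
  "truncated_divergence \<Theta> f \<delta> N x \<theta> =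
     (if divergence \<Theta> f N x \<theta> \<le> ereal (real N powr \<delta>) then divergence \<Theta> f N x \<theta> else \<infinity>)"

text \<open>
  A risk assessment is a functional of laws on the real line.  The penalty \<open>a\<close> is only used
  when it is finite, so that it may be converted to a real number.
\<close>

definition penalized_risk :: "real \<Rightarrow> real \<Rightarrow> ereal \<Rightarrow> ereal \<Rightarrow> ereal" where
  "penalized_risk k \<gamma> r a = r - ereal ((1 / k * real_of_ereal a) powr \<gamma>)"

definition dr_risk ::
  "('p \<Rightarrow> 'a measure) \<Rightarrow> 'p set \<Rightarrow> ('p \<Rightarrow> real \<Rightarrow> real) \<Rightarrow> (nat \<Rightarrow> 'a \<Rightarrow> real) \<Rightarrow>
     real \<Rightarrow> real \<Rightarrow> real \<Rightarrow> (real measure \<Rightarrow> ereal) \<Rightarrow> nat \<Rightarrow> (nat \<Rightarrow> real) \<Rightarrow> ereal" where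
  "dr_risk Q \<Theta> f X k \<gamma> \<delta> R N x =
     (SUP \<theta>\<in>{\<theta>\<in>\<Theta>. truncated_divergence \<Theta> f \<delta> N x \<theta> \<noteq> \<infinity>}.
        penalized_risk k \<gamma> (R (distr (Q \<theta>) borel (X 0))) (truncated_divergence \<Theta> f \<delta> N x \<theta>))"

definition dr_regular ::
  "('p \<Rightarrow> 'a measure) \<Rightarrow> 'p set \<Rightarrow> ('p \<Rightarrow> real \<Rightarrow> real) \<Rightarrow> (nat \<Rightarrow> 'a \<Rightarrow> real) \<Rightarrow>
     real \<Rightarrow> real \<Rightarrow> real \<Rightarrow> (real measure \<Rightarrow> ereal) \<Rightarrow> nat \<Rightarrow> (nat \<Rightarrow> real) \<Rightarrow> bool" where
  "dr_regular Q \<Theta> f X k \<gamma> \<delta> R N x \<longleftrightarrow>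
     \<bar>dr_risk Q \<Theta> f X k \<gamma> \<delta> R N x\<bar> \<noteq> \<infinity> \<and>
     (\<exists>\<theta>\<in>\<Theta>. divergence \<Theta> f N x \<theta> < ereal (real N powr \<delta>) \<and>
        penalized_risk k \<gamma> (R (distr (Q \<theta>) borel (X 0))) (truncated_divergence \<Theta> f \<delta> N x \<theta>)
          = dr_risk Q \<Theta> f X k \<gamma> \<delta> R N x)"

text \<open>
  For arbitrary risk assessments the event of regularity need not be measurable, and
  \<^const>\<open>measure\<close> is zero on nonmeasurable sets; its probability is therefore
  taken as the inner probability, which is the usual one for measurable events.
\<close>

definition inner_prob :: "'a measure \<Rightarrow> 'a set \<Rightarrow> real" where
  "inner_prob P E = (SUP A\<in>{A \<in> sets P. A \<subseteq> E}. measure P A)"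

lemma inner_prob_eq_measure:
  assumes "prob_space P" and "E \<in> sets P"
  shows "inner_prob P E = measure P E"
proof -
  interpret prob_space P by fact
  show ?thesis
    unfolding inner_prob_def
    using assms(2) by (intro cSup_eq_maximum) (auto intro: finite_measure_mono)
qed

definition dr_regularizable ::
  "('p \<Rightarrow> 'a measure) \<Rightarrow> 'p set \<Rightarrow> ('p \<Rightarrow> real \<Rightarrow> real) \<Rightarrow> (nat \<Rightarrow> 'a \<Rightarrow> real) \<Rightarrow>
     real \<Rightarrow> real \<Rightarrow> (nat \<Rightarrow> real measure \<Rightarrow> ereal) \<Rightarrow> bool" where
  "dr_regularizable Q \<Theta> f X k \<gamma> R \<longleftrightarrow>
     (\<exists>\<delta>>0. \<forall>P \<in> Q ` \<Theta>.
        (\<lambda>N. inner_prob P {\<omega> \<in> space P. dr_regular Q \<Theta> f X k \<gamma> \<delta> (R N) N (\<lambda>i. X i \<omega>)})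
          \<longlonglongrightarrow> 1)"

definition integrated_tail :: "real \<Rightarrow> real measure \<Rightarrow> ereal" where
  "integrated_tail \<beta> \<mu> = enn2ereal (\<integral>\<^sup>+ x. ennreal (max 0 (x - \<beta>)) \<partial>\<mu>)"

end

theory Submission
  imports Defs "HOL-Real_Asymp.Real_Asymp"
begin

text \<open>
  With \<open>S = \<Sum> ln X\<^sub>i\<close> and \<open>\<theta>h = N / S\<close> the maximum likelihood estimator, the divergence
  is \<open>N g(\<theta> / \<theta>h)\<close> for \<open>g(t) = t - 1 - ln t\<close>.  Truncating it at \<open>N\<^sup>\<delta>\<close> with \<open>\<delta> = 1/2 < 1\<close> forces
  \<open>g(\<theta> / \<theta>h)\<close> to be small, hence leaves a compact set of parameters; if \<open>\<theta>h > c > 1\<close> and \<open>N\<close> is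
  large, that set stays above \<open>(1 + c) / 2\<close>, so the integrated tail is at most \<open>2 / (c - 1)\<close> on it,
  whatever \<open>\<beta>\<^sub>N\<close>.  The supremum is attained, and not where the divergence equals \<open>N\<^sup>\<delta>\<close>: there
  the penalty \<open>(N\<^sup>\<delta> / k)\<^sup>\<gamma>\<close> exceeds the risk, while the objective at \<open>\<theta>h\<close> is nonnegative.  Finally
  the \<open>ln X\<^sub>i\<close> are exponentially distributed, so Chebyshev's inequality gives \<open>\<theta>h > c\<close> with
  probability tending to one, for any \<open>c\<close> strictly between \<open>1\<close> and the true parameter.
\<close>

section \<open>Attainment of the supremum in the interior of the truncation\<close>

text \<open>The truncated parameter set is compact and the real-valued objective is continuous on
  it, so a maximiser exists by the extreme value theorem. A maximiser with divergence exactly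
  \<open>N powr \<delta>\<close> would be beaten by \<open>\<theta>0\<close>, so the strict
  inequality demanded by regularity follows.\<close>

lemma dr_regularI:
  fixes \<Theta> :: "'p::metric_space set"
  assumes div: "\<And>\<theta>. \<theta> \<in> \<Theta> \<Longrightarrow> divergence \<Theta> f N x \<theta> = ereal (D \<theta>)"
    and D_nonneg: "\<And>\<theta>. \<theta> \<in> \<Theta> \<Longrightarrow> 0 \<le> D \<theta>"
    and risk: "\<And>\<theta>. \<theta> \<in> \<Theta> \<Longrightarrow> R (distr (Q \<theta>) borel (X 0)) = ereal (r \<theta>)"
    and K: "compact {\<theta>\<in>\<Theta>. D \<theta> \<le> real N powr \<delta>}"
    and contD: "continuous_on \<Theta> D" and contr: "continuous_on \<Theta> r"
    and k: "k > 0" and \<gamma>: "\<gamma> > 0"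
    and \<theta>0: "\<theta>0 \<in> \<Theta>" "D \<theta>0 \<le> real N powr \<delta>"
    and boundary: "\<And>\<theta>. \<theta> \<in> \<Theta> \<Longrightarrow> D \<theta> = real N powr \<delta> \<Longrightarrow>
      r \<theta> - (D \<theta> / k) powr \<gamma> < r \<theta>0 - (D \<theta>0 / k) powr \<gamma>"
  shows "dr_regular Q \<Theta> f X k \<gamma> \<delta> R N x"
proof -
  define K where "K = {\<theta>\<in>\<Theta>. D \<theta> \<le> real N powr \<delta>}"
  define h where "h \<theta> = r \<theta> - (D \<theta> / k) powr \<gamma>" for \<theta>
  have "continuous_on K D" "continuous_on K r"
    using contD contr by (auto simp: K_def intro: continuous_on_subset)
  then have "continuous_on K h"
    unfolding h_def using k \<gamma> D_nonneg
    by (intro continuous_intros continuous_on_powr') (auto simp: K_def)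
  moreover have "compact K" "K \<noteq> {}"
    using K \<theta>0 by (auto simp: K_def)
  ultimately obtain \<theta>1 where \<theta>1: "\<theta>1 \<in> K" and max: "\<And>\<theta>. \<theta> \<in> K \<Longrightarrow> h \<theta> \<le> h \<theta>1"
    using continuous_attains_sup[of K h] by blast
  have trunc: "truncated_divergence \<Theta> f \<delta> N x \<theta> = (if \<theta> \<in> K then ereal (D \<theta>) else \<infinity>)"
    if "\<theta> \<in> \<Theta>" for \<theta>
    using that by (auto simp: truncated_divergence_def div K_def)
  have pen: "penalized_risk k \<gamma> (R (distr (Q \<theta>) borel (X 0))) (truncated_divergence \<Theta> f \<delta> N x \<theta>)
      = ereal (h \<theta>)" if "\<theta> \<in> K" for \<theta>
    using that by (simp add: penalized_risk_def trunc K_def risk h_def)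
  have dom: "{\<theta>\<in>\<Theta>. truncated_divergence \<Theta> f \<delta> N x \<theta> \<noteq> \<infinity>} = K"
    using trunc by (auto simp: K_def split: if_splits)
  have dr: "dr_risk Q \<Theta> f X k \<gamma> \<delta> R N x = ereal (h \<theta>1)"
    unfolding dr_risk_def dom
  proof (rule antisym)
    show "(SUP \<theta>\<in>K. penalized_risk k \<gamma> (R (distr (Q \<theta>) borel (X 0)))
        (truncated_divergence \<Theta> f \<delta> N x \<theta>)) \<le> ereal (h \<theta>1)"
      using max pen by (intro SUP_least) simp
    show "ereal (h \<theta>1) \<le> (SUP \<theta>\<in>K. penalized_risk k \<gamma> (R (distr (Q \<theta>) borel (X 0)))
        (truncated_divergence \<Theta> f \<delta> N x \<theta>))"
      using \<theta>1 pen by (intro SUP_upper2[of \<theta>1]) auto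
  qed
  have "D \<theta>1 \<noteq> real N powr \<delta>"
    using boundary[of \<theta>1] max[of \<theta>0] \<theta>0 \<theta>1 by (auto simp: K_def h_def)
  then have "D \<theta>1 < real N powr \<delta>"
    using \<theta>1 by (auto simp: K_def)
  then show ?thesis
    unfolding dr_regular_def dr using \<theta>1 pen[OF \<theta>1] div[of \<theta>1]
    by (auto simp: K_def intro!: bexI[of _ \<theta>1])
qed

section \<open>Likelihood and divergence of the Pareto model\<close>

text \<open>Observations above 1 have positive density, so the branch with value minus infinity
  never occurs.\<close>

lemma log_lik_pareto:
  assumes "\<theta> > 0" and "\<And>i. i \<in> {1..N} \<Longrightarrow> x i > 1"
  shows "log_lik pareto_density N x \<theta> = ereal (real N * ln \<theta> - (1 + \<theta>) * (\<Sum>i=1..N. ln (x i)))"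
proof -
  have "log_lik pareto_density N x \<theta> = (\<Sum>i=1..N. ereal (ln \<theta> - (1 + \<theta>) * ln (x i)))"
    unfolding log_lik_def
  proof (intro sum.cong refl)
    fix i assume "i \<in> {1..N}"
    then have x: "x i > 1" using assms by auto
    then have "pareto_density \<theta> (x i) > 0"
      using assms(1) by (simp add: pareto_density_def)
    moreover have "ln (pareto_density \<theta> (x i)) = ln \<theta> - (1 + \<theta>) * ln (x i)"
      using x assms(1) by (simp add: pareto_density_def ln_mult ln_powr algebra_simps)
    ultimately show "(if 0 < pareto_density \<theta> (x i) then ereal (ln (pareto_density \<theta> (x i))) else - \<infinity>)
      = ereal (ln \<theta> - (1 + \<theta>) * ln (x i))" by simp
  qed
  then show ?thesis
    by (simp add: sum_subtractf sum_distrib_left)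
qed

text \<open>The Itakura-Saito divergence of \<open>t\<close> from 1, which is also the
  Kullback-Leibler divergence of the rate-1 exponential law relative to the rate-\<open>t\<close>
  one.\<close>

definition itakura_saito :: "real \<Rightarrow> real" where
  "itakura_saito t = t - 1 - ln t"

lemma itakura_saito_nonneg: "t > 0 \<Longrightarrow> itakura_saito t \<ge> 0"
  using ln_le_minus_one[of t] by (simp add: itakura_saito_def)

lemma itakura_saito_pos: "t > 0 \<Longrightarrow> t \<noteq> 1 \<Longrightarrow> itakura_saito t > 0"
  using ln_le_minus_one[of t] ln_eq_minus_one[of t] by (fastforce simp: itakura_saito_def)

text \<open>Provides the lower bound on the parameters that survive truncation.\<close>

lemma itakura_saito_antimono:
  assumes "0 < s" "s \<le> t" "t \<le> 1"
  shows "itakura_saito t \<le> itakura_saito s"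
proof -
  have "ln s - ln t \<le> (s - t) / t"
    using ln_diff_le assms by simp
  \<comment> \<open>The numerator is nonpositive, so enlarging the denominator from \<open>t\<close>
    to 1 increases the quotient.\<close>
  also have "\<dots> \<le> (s - t) / 1"
    using assms by (intro divide_left_mono_neg) auto
  finally show ?thesis by (simp add: itakura_saito_def)
qed

text \<open>Linear growth bounds the surviving parameters from above. Halving \<open>t\<close>
  inside the logarithm leaves slope 1/2 after \<open>ln u \<le> u - 1\<close>.\<close>

lemma itakura_saito_ge_linear:
  assumes "t > 0"
  shows "itakura_saito t \<ge> t / 2 - 1"
proof -
  have "ln t = ln (t / 2) + ln 2"
    using assms by (simp add: ln_div)
  also have "\<dots> \<le> (t / 2 - 1) + 1"
    using assms ln_le_minus_one[of "t / 2"] ln_le_minus_one[of 2] by linarith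
  finally show ?thesis by (simp add: itakura_saito_def)
qed

text \<open>The log-likelihood falls short of its value at \<open>\<theta>h\<close> by
  \<open>N * itakura_saito (t / \<theta>h)\<close>, which is nonnegative. Since
  \<open>\<theta>h > 1\<close>, the maximiser lies in the open parameter set and the supremum is
  attained there.\<close>

lemma divergence_pareto:
  fixes N :: nat and x :: "nat \<Rightarrow> real"
  defines "\<theta>h \<equiv> real N / (\<Sum>i=1..N. ln (x i))"
  assumes "\<theta> > 1" and x: "\<And>i. i \<in> {1..N} \<Longrightarrow> x i > 1" and \<theta>h: "\<theta>h > 1"
  shows "divergence {1<..} pareto_density N x \<theta> = ereal (real N * itakura_saito (\<theta> / \<theta>h))"
proof -
  define S where "S = (\<Sum>i=1..N. ln (x i))"
  define L where "L \<theta> = real N * ln \<theta> - (1 + \<theta>) * S" for \<theta>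
  \<comment> \<open>With \<open>S \<le> 0\<close> the quotient \<open>\<theta>h\<close> would be
    nonpositive, also for \<open>S = 0\<close>, where division yields 0.\<close>
  have S: "S > 0" and NS: "real N = \<theta>h * S"
    using \<theta>h divide_nonneg_nonpos[of "real N" S] by (force simp: \<theta>h_def S_def)+
  have lik: "log_lik pareto_density N x t = ereal (L t)" if "t > 1" for t
    unfolding L_def S_def using that x by (intro log_lik_pareto) auto
  have diff: "L \<theta>h - L t = real N * itakura_saito (t / \<theta>h)" if "t > 0" for t
    using that \<theta>h by (simp add: L_def itakura_saito_def ln_div NS field_simps)
  have "(SUP \<theta>'\<in>{1<..}. log_lik pareto_density N x \<theta>') = (SUP \<theta>'\<in>{1<..}. ereal (L \<theta>'))"
    by (intro SUP_cong) (simp_all add: lik)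
  also have "\<dots> = ereal (L \<theta>h)"
  proof (rule antisym)
    show "(SUP \<theta>'\<in>{1<..}. ereal (L \<theta>')) \<le> ereal (L \<theta>h)"
    proof (rule SUP_least)
      fix t :: real assume "t \<in> {1<..}"
      then show "ereal (L t) \<le> ereal (L \<theta>h)"
        using diff[of t] itakura_saito_nonneg[of "t / \<theta>h"] \<theta>h
        by (simp add: le_diff_eq) (smt (verit) mult_nonneg_nonneg of_nat_0_le_iff)
    qed
  qed (use \<theta>h in \<open>auto intro: SUP_upper\<close>)
  finally show ?thesis
    using \<open>\<theta> > 1\<close> diff[of \<theta>] by (simp add: divergence_def lik)
qed

section \<open>Two integrals: the integrated tail and the law of the logarithm\<close>

lemma integrated_tail_pareto:
  assumes "distributed P lborel X (\<lambda>x. ennreal (pareto_density \<theta> x))" and "\<theta> > 1" and "\<beta> \<ge> 1"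
  shows "integrated_tail \<beta> (distr P borel X) = ereal (\<beta> powr (1 - \<theta>) / (\<theta> - 1))"
proof -
  have [measurable]: "X \<in> borel_measurable P"
    using distributed_measurable[OF assms(1)] by simp
  \<comment> \<open>An antiderivative of \<open>f\<close>; both powers vanish at infinity because
    \<open>\<theta> > 1\<close>.\<close>
  define F where "F x = \<beta> * x powr (- \<theta>) - \<theta> / (\<theta> - 1) * x powr (1 - \<theta>)" for x
  define f where "f x = \<theta> * x powr (- (1 + \<theta>)) * (x - \<beta>)" for x
  have "(\<integral>\<^sup>+ x. ennreal (max 0 (x - \<beta>)) \<partial>distr P borel X) = (\<integral>\<^sup>+ \<omega>. ennreal (max 0 (X \<omega> - \<beta>)) \<partial>P)"
    by (simp add: nn_integral_distr)
  also have "\<dots> = (\<integral>\<^sup>+ x. ennreal (pareto_density \<theta> x) * ennreal (max 0 (x - \<beta>)) \<partial>lborel)"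
    by (rule distributed_nn_integral[OF assms(1), symmetric]) simp
  \<comment> \<open>For \<open>\<beta> = 1\<close> the density is 0 at the endpoint, but there
    \<open>f\<close> vanishes too, through its factor \<open>x - \<beta>\<close>.\<close>
  also have "\<dots> = (\<integral>\<^sup>+ x. ennreal (f x) * indicator {\<beta>..} x \<partial>lborel)"
    using assms(2,3) by (intro nn_integral_cong)
      (auto simp: f_def pareto_density_def ennreal_mult'[symmetric] max_def split: split_indicator)
  also have "\<dots> = ennreal (0 - F \<beta>)"
  proof (rule nn_integral_FTC_atLeast)
    show "f \<in> borel_measurable borel" unfolding f_def by measurable
    fix x assume x: "\<beta> \<le> x"
    then show "0 \<le> f x" using assms by (simp add: f_def)
    have "x > 0" using x assms by simp
    then have "x powr (- \<theta>) = x * x powr (- \<theta> - 1)"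
      using powr_add[of x 1 "- \<theta> - 1"] by simp
    with \<open>x > 0\<close> show "(F has_real_derivative f x) (at x)"
      unfolding F_def f_def using assms(2)
      by (auto intro!: derivative_eq_intros simp: minus_diff_commute) (simp add: field_simps)
  next
    have "((\<lambda>x. x powr (- \<theta>)) \<longlongrightarrow> 0) at_top" "((\<lambda>x. x powr (1 - \<theta>)) \<longlongrightarrow> 0) at_top"
      using assms(2) by (intro tendsto_neg_powr filterlim_ident; simp)+
    then have "(F \<longlongrightarrow> \<beta> * 0 - \<theta> / (\<theta> - 1) * 0) at_top"
      unfolding F_def by (intro tendsto_intros)
    then show "(F \<longlongrightarrow> 0) at_top" by simp
  qed
  also have "0 - F \<beta> = \<beta> powr (1 - \<theta>) / (\<theta> - 1)"
  proof -
    have "\<beta> powr (1 - \<theta>) = \<beta> * \<beta> powr (- \<theta>)"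
      using powr_add[of \<beta> 1 "- \<theta>"] assms(3) by simp
    then show ?thesis using assms(2) by (simp add: F_def field_simps)
  qed
  finally show ?thesis
    using assms by (simp add: integrated_tail_def enn2ereal_ennreal)
qed

text \<open>The event \<open>ln X \<le> a\<close> is almost surely \<open>1 < X \<le> exp a\<close>,
  which has probability \<open>1 - exp (- a * \<theta>)\<close>, the exponential distribution
  function.\<close>

lemma distributed_ln_pareto:
  assumes "distributed P lborel X (\<lambda>x. ennreal (pareto_density \<theta> x))" and "\<theta> > 0"
    and "prob_space P"
  shows "distributed P lborel (\<lambda>\<omega>. ln (X \<omega>)) (exponential_density \<theta>)"
proof -
  interpret prob_space P by fact
  have [measurable]: "X \<in> borel_measurable P"
    using distributed_measurable[OF assms(1)] by simp
  show ?thesis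
  proof (rule exponential_distributedI)
    fix a :: real assume a: "0 \<le> a"
    have "{\<omega> \<in> space P. ln (X \<omega>) \<le> a} = X -` {x. ln x \<le> a} \<inter> space P"
      by auto
    also have "emeasure P \<dots> = (\<integral>\<^sup>+ x. ennreal (pareto_density \<theta> x) * indicator {x. ln x \<le> a} x \<partial>lborel)"
      by (rule distributed_emeasure[OF assms(1)]) simp
    also have "\<dots> = (\<integral>\<^sup>+ x. ennreal (\<theta> * x powr (- (1 + \<theta>))) * indicator {1..exp a} x \<partial>lborel)"
    \<comment> \<open>The integrands may differ only at 1. Values of \<open>ln\<close> at
      nonpositive arguments are harmless, as the density is 0 there.\<close>
    proof (rule nn_integral_cong_AE)
      have *: "ln x \<le> a \<longleftrightarrow> x \<le> exp a" if "x > 1" for x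
        using that by (metis exp_le_cancel_iff exp_ln less_trans zero_less_one)
      then show "AE x in lborel. ennreal (pareto_density \<theta> x) * indicator {x. ln x \<le> a} x
        = ennreal (\<theta> * x powr (- (1 + \<theta>))) * indicator {1..exp a} x"
        by (intro eventually_mono[OF AE_lborel_singleton[of 1]])
          (auto simp: pareto_density_def * split: split_indicator)
    qed
    also have "\<dots> = ennreal (- (exp a powr (- \<theta>)) - - (1 powr (- \<theta>)))"
    proof (rule nn_integral_FTC_Icc)
      fix x assume "x \<in> {1..exp a}"
      then show "((\<lambda>x. - (x powr (- \<theta>))) has_real_derivative \<theta> * x powr (- (1 + \<theta>))) (at x)"
        by (auto intro!: derivative_eq_intros simp: minus_diff_commute)
    qed (use a \<open>\<theta> > 0\<close> in auto)
    also have "\<dots> = 1 - ennreal (exp (- a * \<theta>))"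
      by (simp add: powr_def mult.commute ennreal_minus flip: ennreal_1)
    finally show "emeasure P {\<omega> \<in> space P. ln (X \<omega>) \<le> a} = 1 - ennreal (exp (- a * \<theta>))" .
  qed (use assms in auto)
qed

section \<open>Regularity for good observations\<close>

text \<open>Purely deterministic in the data: \<open>S\<close> places the estimator above
  \<open>c\<close>, \<open>large1\<close> keeps the truncated set away from 1, and
  \<open>large2\<close> lets the boundary penalty dominate the risk. The level enters the risk bound
  only through \<open>\<beta> powr (1 - \<theta>) \<le> 1\<close>, hence uniformly.\<close>

lemma dr_regular_pareto:
  fixes N :: nat and c :: real
  assumes Q: "\<And>\<theta>. \<theta> > 1 \<Longrightarrow> distributed (Q \<theta>) lborel (X 0) (\<lambda>x. ennreal (pareto_density \<theta> x))"
    and k: "k > 0" and \<gamma>: "\<gamma> > 0" and \<beta>: "\<beta> \<ge> 1" and N: "N > 0" and c: "c > 1"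
    and x: "\<And>i. i \<in> {1..N} \<Longrightarrow> x i > 1"
    and S: "(\<Sum>i=1..N. ln (x i)) < real N / c"
    and large1: "real N powr (1/2) < real N * itakura_saito ((1 + c) / (2 * c))"
    and large2: "2 / (c - 1) < (real N powr (1/2) / k) powr \<gamma>"
  shows "dr_regular Q {1<..} pareto_density X k \<gamma> (1/2) (integrated_tail \<beta>) N x"
proof -
  define S where "S = (\<Sum>i=1..N. ln (x i))"
  define \<theta>h where "\<theta>h = real N / S"
  define D where "D \<theta> = real N * itakura_saito (\<theta> / \<theta>h)" for \<theta>
  \<comment> \<open>The midpoint of 1 and \<open>c\<close>: \<open>d / c\<close> is the argument in
    \<open>large1\<close>, and \<open>1 / (d - 1)\<close> is the bound in
    \<open>large2\<close>.\<close>
  define d where "d = (1 + c) / 2"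
  define b where "b = real N powr (1/2)"
  have "S > 0"
    unfolding S_def using x N by (intro sum_pos ln_gt_zero) auto
  then have \<theta>h: "\<theta>h > c"
    using S c by (simp add: \<theta>h_def S_def field_simps)
  have d: "d > 1" "d < c" using c by (auto simp: d_def)
  have D_lower: "\<theta> \<ge> d" if "\<theta> > 0" "D \<theta> \<le> b" for \<theta>
  proof (rule ccontr)
    assume "\<not> \<theta> \<ge> d"
    then have "\<theta> / \<theta>h \<le> d / c"
      using that \<theta>h c d by (intro frac_le) auto
    then have "itakura_saito (d / c) \<le> itakura_saito (\<theta> / \<theta>h)"
      using that \<theta>h c d by (intro itakura_saito_antimono) auto
    then have "real N * itakura_saito (d / c) \<le> D \<theta>"
      by (simp add: D_def mult_left_mono)
    with large1 that show False by (simp add: d_def b_def)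
  qed
  \<comment> \<open>Solves \<open>\<theta> / \<theta>h / 2 - 1 \<le> b / N\<close> for
    \<open>\<theta>\<close>.\<close>
  define B where "B = 2 * \<theta>h * (b / real N + 1)"
  have D_upper: "\<theta> \<le> B" if "\<theta> > 0" "D \<theta> \<le> b" for \<theta>
  proof -
    have "\<theta> / \<theta>h / 2 - 1 \<le> itakura_saito (\<theta> / \<theta>h)"
      using that \<theta>h c by (intro itakura_saito_ge_linear) auto
    also have "\<dots> \<le> b / real N"
      using that N by (simp add: D_def field_simps)
    finally show ?thesis using \<theta>h c by (simp add: B_def field_simps)
  qed
  have contD: "continuous_on {0<..} D"
    unfolding D_def itakura_saito_def using \<theta>h c by (intro continuous_intros) auto
  \<comment> \<open>The parameter set is open at 1; compactness becomes visible after replacing it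
    by a closed interval.\<close>
  have K_eq: "{\<theta>\<in>{1<..}. D \<theta> \<le> b} = {\<theta>\<in>{d..B}. D \<theta> \<le> b}"
    using D_lower D_upper d by fastforce
  have "compact {\<theta>\<in>{d..B}. D \<theta> \<le> b}"
  proof -
    have "closed ({d..B} \<inter> D -` {..b})"
      using d by (intro continuous_closed_preimage continuous_on_subset[OF contD]) auto
    then have "compact ({d..B} \<inter> ({d..B} \<inter> D -` {..b}))"
      by (intro compact_Int_closed) auto
    also have "{d..B} \<inter> ({d..B} \<inter> D -` {..b}) = {\<theta>\<in>{d..B}. D \<theta> \<le> b}" by auto
    finally show ?thesis .
  qed
  then have K: "compact {\<theta>\<in>{1<..}. D \<theta> \<le> real N powr (1/2)}"
    by (simp only: K_eq b_def[symmetric])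
  have D0: "D \<theta>h = 0"
    using \<theta>h c by (simp add: D_def itakura_saito_def)
  show ?thesis
  proof (rule dr_regularI[where D = D and r = "\<lambda>\<theta>. \<beta> powr (1 - \<theta>) / (\<theta> - 1)" and ?\<theta>0.0 = \<theta>h])
    fix \<theta> :: real assume \<theta>: "\<theta> \<in> {1<..}"
    show "divergence {1<..} pareto_density N x \<theta> = ereal (D \<theta>)"
      using divergence_pareto[of \<theta> N x] \<theta> x \<theta>h c by (simp add: D_def \<theta>h_def S_def)
    show "0 \<le> D \<theta>"
      using \<theta> \<theta>h c by (auto simp: D_def intro!: mult_nonneg_nonneg itakura_saito_nonneg)
    show "integrated_tail \<beta> (distr (Q \<theta>) borel (X 0)) = ereal (\<beta> powr (1 - \<theta>) / (\<theta> - 1))"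
      using \<theta> \<beta> by (intro integrated_tail_pareto Q) auto
    assume "D \<theta> = real N powr (1/2)"
    then have Db: "D \<theta> = b" by (simp add: b_def)
    then have "\<theta> \<ge> d" using D_lower \<theta> by simp
    have "\<beta> powr (1 - \<theta>) \<le> \<beta> powr 0"
      using \<theta> \<beta> by (intro powr_mono) auto
    then have "\<beta> powr (1 - \<theta>) / (\<theta> - 1) \<le> 1 / (d - 1)"
      using \<open>\<theta> \<ge> d\<close> d \<beta> by (intro frac_le) auto
    also have "\<dots> = 2 / (c - 1)"
      using c by (simp add: d_def field_simps)
    also have "\<dots> < (D \<theta> / k) powr \<gamma>"
      using large2 by (simp add: Db b_def)
    also have "\<dots> \<le> (D \<theta> / k) powr \<gamma> + \<beta> powr (1 - \<theta>h) / (\<theta>h - 1)"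
      using \<theta>h c by simp
    finally show "\<beta> powr (1 - \<theta>) / (\<theta> - 1) - (D \<theta> / k) powr \<gamma>
        < \<beta> powr (1 - \<theta>h) / (\<theta>h - 1) - (D \<theta>h / k) powr \<gamma>"
      using \<gamma> by (simp add: D0)
  next
    show "continuous_on {1<..} (\<lambda>\<theta>. \<beta> powr (1 - \<theta>) / (\<theta> - 1))"
      using \<beta> by (intro continuous_intros) auto
    show "continuous_on {1<..} D"
      by (rule continuous_on_subset[OF contD]) auto
  qed (use K k \<gamma> \<theta>h c D0 in auto)
qed

section \<open>Concentration and inner probability\<close>

lemma pareto_sum_ln_concentration:
  assumes "prob_space P"
    and "prob_space.indep_vars P (\<lambda>_. borel) X UNIV"
    and X: "\<And>i::nat. distributed P lborel (X i) (\<lambda>x. ennreal (pareto_density \<theta> x))"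
    and \<theta>: "\<theta> > 0" and "N > 0" and "\<epsilon> > 0"
  defines "A \<equiv> {\<omega> \<in> space P. (\<forall>i\<in>{1..N}. X i \<omega> > 1) \<and>
      (\<Sum>i=1..N. ln (X i \<omega>)) < real N * (1 / \<theta> + \<epsilon>)}"
  shows "A \<in> sets P" and "measure P A \<ge> 1 - 1 / (\<theta> * \<epsilon>)\<^sup>2 / real N"
proof -
  interpret prob_space P by fact
  have [measurable]: "X i \<in> borel_measurable P" for i
    using distributed_measurable[OF X] by simp
  show A[measurable]: "A \<in> sets P" unfolding A_def by measurable
  define S where "S \<omega> = (\<Sum>i=1..N. ln (X i \<omega>))" for \<omega>
  have [measurable]: "S \<in> borel_measurable P" unfolding S_def by measurable
  have "indep_vars (\<lambda>_. borel) (\<lambda>i \<omega>. ln (X i \<omega>)) UNIV"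
    using assms(2) by (rule indep_vars_compose2) simp
  then have "indep_vars (\<lambda>_. borel) (\<lambda>i \<omega>. ln (X i \<omega>)) {1..N}"
    by (rule indep_vars_subset) simp
  \<comment> \<open>The shape argument of \<open>erlang_density\<close> is one less than the number
    of exponential summands.\<close>
  then have "distributed P lborel S (erlang_density (card {1..N} - 1) \<theta>)"
    unfolding S_def using \<open>N > 0\<close> \<theta> assms(1)
    by (intro exponential_distributed_sum distributed_ln_pareto X) auto
  then have S: "distributed P lborel S (erlang_density (N - 1) \<theta>)" by simp
  have ES: "expectation S = real N / \<theta>"
    using erlang_ith_moment[OF \<theta> S, of 1] \<open>N > 0\<close> by (cases N) auto
  have VS: "variance S = real N / \<theta>\<^sup>2"
    using erlang_distributed_variance[OF \<theta> S] \<open>N > 0\<close> by (simp add: of_nat_diff)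
  define B where "B = {\<omega> \<in> space P. \<bar>S \<omega> - expectation S\<bar> \<ge> real N * \<epsilon>}"
  have B[measurable]: "B \<in> sets P" unfolding B_def by measurable
  have "prob B \<le> variance S / (real N * \<epsilon>)\<^sup>2"
    unfolding B_def using \<open>N > 0\<close> \<open>\<epsilon> > 0\<close> erlang_ith_moment_integrable[OF \<theta> S]
    by (intro Chebyshev_inequality) auto
  also have "\<dots> = 1 / (\<theta> * \<epsilon>)\<^sup>2 / real N"
    unfolding VS using \<open>N > 0\<close> \<open>\<epsilon> > 0\<close> \<theta> by (simp add: field_simps power2_eq_square)
  finally have "prob B \<le> 1 / (\<theta> * \<epsilon>)\<^sup>2 / real N" .
  then have "1 - 1 / (\<theta> * \<epsilon>)\<^sup>2 / real N \<le> prob (space P - B)"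
    by (simp add: prob_compl)
  also have "\<dots> \<le> prob A"
  \<comment> \<open>The inclusion holds only up to a null set, because \<open>A\<close> also
    requires every observation to exceed 1.\<close>
  proof (rule finite_measure_mono_AE)
    have "AE \<omega> in P. X i \<omega> > 1" for i
      by (subst distributed_AE2[OF X]) (auto simp: pareto_density_def)
    then have "AE \<omega> in P. \<forall>i\<in>{1..N}. X i \<omega> > 1" by (intro AE_finite_allI) auto
    then show "AE \<omega> in P. \<omega> \<in> space P - B \<longrightarrow> \<omega> \<in> A"
    proof eventually_elim
      case (elim \<omega>)
      have "S \<omega> < real N * (1 / \<theta> + \<epsilon>)" if "\<bar>S \<omega> - real N / \<theta>\<bar> < real N * \<epsilon>"
        using that by (simp add: distrib_left)
      with elim show ?case by (auto simp: A_def B_def S_def ES)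
    qed
  qed simp
  finally show "measure P A \<ge> 1 - 1 / (\<theta> * \<epsilon>)\<^sup>2 / real N" .
qed

text \<open>Lets a measurable event inside the regularity event bound its inner probability from
  below, without any measurability of the regularity event itself.\<close>

lemma inner_prob_bounds:
  assumes "prob_space P" "A \<in> sets P" "A \<subseteq> E"
  shows "measure P A \<le> inner_prob P E" "inner_prob P E \<le> 1"
proof -
  interpret prob_space P by fact
  have "bdd_above (measure P ` {A \<in> sets P. A \<subseteq> E})"
    by (rule bdd_aboveI[of _ 1]) auto
  then show "measure P A \<le> inner_prob P E"
    unfolding inner_prob_def using assms by (intro cSUP_upper) auto
  show "inner_prob P E \<le> 1"
    unfolding inner_prob_def using assms by (intro cSUP_least) auto
qed

theorem theorem5:
  fixes M :: "'a measure"
    and Q :: "real \<Rightarrow> 'a measure"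
    and X :: "nat \<Rightarrow> 'a \<Rightarrow> real"
    and k \<gamma> :: real
    and \<beta> :: "nat \<Rightarrow> real"
  assumes "iid_density_model M {1<..} pareto_density Q X"
    and "k > 0"
    and "\<gamma> \<ge> 1"
    and "\<forall>N\<ge>1. \<beta> N \<ge> 1"
  shows "dr_regularizable Q {1<..} pareto_density X k \<gamma> (\<lambda>N. integrated_tail (\<beta> N))"
  unfolding dr_regularizable_def
\<comment> \<open>The exponent 1/2 makes \<open>N powr (1/2)\<close> negligible against
  \<open>N\<close>, yet unbounded, as \<open>ev1\<close> and \<open>ev2\<close> require.\<close>
proof (intro exI[of _ "1/2"] conjI ballI)
  have Q: "distributed (Q \<theta>) lborel (X i) (\<lambda>x. ennreal (pareto_density \<theta> x))" if "\<theta> > 1" for \<theta> i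
    using assms(1) that by (auto simp: iid_density_model_def)
  fix P assume "P \<in> Q ` {1<..}"
  then obtain \<theta> where \<theta>: "\<theta> > 1" and P: "P = Q \<theta>" by auto
  have prob: "prob_space P" and indep: "prob_space.indep_vars P (\<lambda>_. borel) X UNIV"
    using assms(1) \<theta> by (auto simp: iid_density_model_def P)
  define c where "c = (1 + \<theta>) / 2"
  \<comment> \<open>Chosen so that \<open>1 / \<theta> + \<epsilon> = 1 / c\<close>, which turns the
    concentration event into \<open>S < N / c\<close>.\<close>
  define \<epsilon> where "\<epsilon> = 1 / c - 1 / \<theta>"
  have c: "c > 1" "c < \<theta>" using \<theta> by (auto simp: c_def)
  then have \<epsilon>: "\<epsilon> > 0" by (simp add: \<epsilon>_def frac_less2)
  define m where "m = itakura_saito ((1 + c) / (2 * c))"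
  have "m > 0"
    unfolding m_def using c by (intro itakura_saito_pos) (auto simp: field_simps)
  have ev1: "eventually (\<lambda>N. real N powr (1/2) < real N * m) sequentially"
    using \<open>m > 0\<close> by real_asymp
  have ev2: "eventually (\<lambda>N. 2 / (c - 1) < (real N powr (1/2) / k) powr \<gamma>) sequentially"
  proof -
    have "filterlim (\<lambda>N. (real N powr (1/2) / k) powr \<gamma>) at_top sequentially"
      using \<open>k > 0\<close> \<open>\<gamma> \<ge> 1\<close> by real_asymp
    then show ?thesis by (simp add: filterlim_at_top_dense)
  qed
  let ?E = "\<lambda>N. {\<omega> \<in> space P. dr_regular Q {1<..} pareto_density X k \<gamma> (1/2)
    (integrated_tail (\<beta> N)) N (\<lambda>i. X i \<omega>)}"
  have lower: "eventually (\<lambda>N. 1 - 1 / (\<theta> * \<epsilon>)\<^sup>2 / real N \<le> inner_prob P (?E N)) sequentially"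
    using ev1 ev2 eventually_gt_at_top[of 0]
  proof eventually_elim
    case (elim N)
    define A where "A = {\<omega> \<in> space P. (\<forall>i\<in>{1..N}. X i \<omega> > 1) \<and>
      (\<Sum>i=1..N. ln (X i \<omega>)) < real N * (1 / \<theta> + \<epsilon>)}"
    have A: "A \<in> sets P" "1 - 1 / (\<theta> * \<epsilon>)\<^sup>2 / real N \<le> measure P A"
      unfolding A_def
      using pareto_sum_ln_concentration[OF prob indep Q[OF \<theta>, folded P] _ elim(3) \<epsilon>] \<theta> by auto
    have "A \<subseteq> ?E N"
    proof
      fix \<omega> assume "\<omega> \<in> A"
      then have "\<omega> \<in> space P" "\<And>i. i \<in> {1..N} \<Longrightarrow> X i \<omega> > 1"
        "(\<Sum>i=1..N. ln (X i \<omega>)) < real N / c"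
        by (auto simp: A_def \<epsilon>_def)
      then show "\<omega> \<in> ?E N"
        using elim assms c by (auto intro!: dr_regular_pareto[where c = c] Q simp: m_def)
    qed
    from inner_prob_bounds(1)[OF prob A(1) this] A(2) show ?case by linarith
  qed
  show "(\<lambda>N. inner_prob P (?E N)) \<longlonglongrightarrow> 1"
  proof (rule tendsto_sandwich[OF lower])
    show "eventually (\<lambda>N. inner_prob P (?E N) \<le> 1) sequentially"
      \<comment> \<open>The empty set serves as a measurable subset of any event.\<close>
      using inner_prob_bounds(2)[OF prob, of "{}"] by simp
    show "(\<lambda>N. 1 - 1 / (\<theta> * \<epsilon>)\<^sup>2 / real N) \<longlonglongrightarrow> 1"
      by real_asymp
  qed simp
qed simp

end
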